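(* Every finite nilpotent group of nilpotency class $2$ satisfies the EKR-module property; that is, every transitive action of such a group satisfies the EKR-module property.
   Context: Let $G$ be a finite group acting transitively on a set $\Omega$. Elements $\sigma,\tau\in G$ intersect if $\sigma\tau^{-1}$ fixes a point of $\Omega$; a subset of $G$ is an intersecting set if any two of its elements intersect; a maximum intersecting set is an intersecting set of maximum possible size. For $S\subseteq G$, $\mathbf{v}_S=\sum_{s\in S}s\in\mathbb{C}G$ is its characteristic vector in the group algebra. The canonical vectors are $\mathbf{v}_{\alpha,\beta}=\sum_{t\in G,\ t\cdot\alpha=\beta}t$ for $\alpha,\beta\in\Omega$. The action of $G$ on $\Omega$ satisfies the EKR-module property if the characteristic vector of each maximum intersecting set is a $\mathbb{C}$-linear combination of canonical vectors. A finite group is said to satisfy the EKR-module property if every transitive action of it satisfies the EKR-module property. (Actions are not required to be faithful.) *)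

theory Defs
  imports
    Complex_Main
    "HOL-Library.Indicator_Function"
    "HOL-Algebra.Generated_Groups"
    "HOL-Algebra.Group_Action"
begin

text \<open>
  The index is shifted by one: \<open>lower_central G n\<close> is the term usually written
  \<open>\<gamma>\<^sub>n\<^sub>+\<^sub>1(G)\<close>, so that \<open>G\<close> has class at most \<open>n\<close> iff \<open>lower_central G n\<close> is trivial.
\<close>

primrec lower_central :: "('a, 'm) monoid_scheme \<Rightarrow> nat \<Rightarrow> 'a set" where
  "lower_central G 0 = carrier G"
| "lower_central G (Suc n) =
     generate G {x \<otimes>\<^bsub>G\<^esub> y \<otimes>\<^bsub>G\<^esub> inv\<^bsub>G\<^esub> x \<otimes>\<^bsub>G\<^esub> inv\<^bsub>G\<^esub> y | x y.
                   x \<in> lower_central G n \<and> y \<in> carrier G}"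

definition nilpotent_group :: "('a, 'm) monoid_scheme \<Rightarrow> bool" where
  "nilpotent_group G \<longleftrightarrow> group G \<and> (\<exists>n. lower_central G n = {\<one>\<^bsub>G\<^esub>})"

definition nilpotency_class :: "('a, 'm) monoid_scheme \<Rightarrow> nat" where
  "nilpotency_class G = (LEAST n. lower_central G n = {\<one>\<^bsub>G\<^esub>})"

definition intersects ::
  "('a, 'm) monoid_scheme \<Rightarrow> 'b set \<Rightarrow> ('a \<Rightarrow> 'b \<Rightarrow> 'b) \<Rightarrow> 'a \<Rightarrow> 'a \<Rightarrow> bool" where
  "intersects G \<Omega> \<phi> \<sigma> \<tau> \<longleftrightarrow> (\<exists>\<omega>\<in>\<Omega>. \<phi> (\<sigma> \<otimes>\<^bsub>G\<^esub> inv\<^bsub>G\<^esub> \<tau>) \<omega> = \<omega>)"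

definition intersecting_set ::
  "('a, 'm) monoid_scheme \<Rightarrow> 'b set \<Rightarrow> ('a \<Rightarrow> 'b \<Rightarrow> 'b) \<Rightarrow> 'a set \<Rightarrow> bool" where
  "intersecting_set G \<Omega> \<phi> S \<longleftrightarrow>
     S \<subseteq> carrier G \<and> (\<forall>\<sigma>\<in>S. \<forall>\<tau>\<in>S. intersects G \<Omega> \<phi> \<sigma> \<tau>)"

definition maximum_intersecting_set ::
  "('a, 'm) monoid_scheme \<Rightarrow> 'b set \<Rightarrow> ('a \<Rightarrow> 'b \<Rightarrow> 'b) \<Rightarrow> 'a set \<Rightarrow> bool" where
  "maximum_intersecting_set G \<Omega> \<phi> S \<longleftrightarrow>
     intersecting_set G \<Omega> \<phi> S \<and> (\<forall>T. intersecting_set G \<Omega> \<phi> T \<longrightarrow> card T \<le> card S)"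

text \<open>
  An element \<open>\<Sum>g\<in>G. a\<^sub>g g\<close> of the group algebra of a finite group \<open>G\<close> over the complex numbers
  is represented by its coefficient function \<open>g \<mapsto> a\<^sub>g\<close>, which is zero outside \<open>carrier G\<close>.
  Only the vector space structure of the group algebra is needed.
\<close>

definition char_vector :: "'a set \<Rightarrow> 'a \<Rightarrow> complex" where
  "char_vector S = indicator S"

definition canonical_vector ::
  "('a, 'm) monoid_scheme \<Rightarrow> ('a \<Rightarrow> 'b \<Rightarrow> 'b) \<Rightarrow> 'b \<Rightarrow> 'b \<Rightarrow> 'a \<Rightarrow> complex" where
  "canonical_vector G \<phi> \<alpha> \<beta> = char_vector {t \<in> carrier G. \<phi> t \<alpha> = \<beta>}"

definition canonical_combination ::
  "('a, 'm) monoid_scheme \<Rightarrow> 'b set \<Rightarrow> ('a \<Rightarrow> 'b \<Rightarrow> 'b) \<Rightarrow> ('a \<Rightarrow> complex) \<Rightarrow> bool" where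
  "canonical_combination G \<Omega> \<phi> v \<longleftrightarrow>
     (\<exists>P c. finite P \<and> P \<subseteq> \<Omega> \<times> \<Omega> \<and>
        v = (\<lambda>g. \<Sum>(\<alpha>, \<beta>)\<in>P. c \<alpha> \<beta> * canonical_vector G \<phi> \<alpha> \<beta> g))"

definition EKR_module_property ::
  "('a, 'm) monoid_scheme \<Rightarrow> 'b set \<Rightarrow> ('a \<Rightarrow> 'b \<Rightarrow> 'b) \<Rightarrow> bool" where
  "EKR_module_property G \<Omega> \<phi> \<longleftrightarrow>
     (\<forall>S. maximum_intersecting_set G \<Omega> \<phi> S \<longrightarrow> canonical_combination G \<Omega> \<phi> (char_vector S))"

end

theory Submission
  imports Defs "HOL-Library.Function_Algebras"
begin

text \<open>
  Let \<open>H\<close> be a point stabilizer, \<open>Z\<close> the center, \<open>[h, g] = h g h\<^sup>-\<^sup>1 g\<^sup>-\<^sup>1\<close>, and let \<open>S\<close> be a maximum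
  intersecting set. In class two all commutators are central, so every conjugate of \<open>H\<close> lies
  in \<open>H Z\<close>, and for fixed \<open>h\<close> the map \<open>g \<mapsto> [h, g]\<close> is a homomorphism into \<open>Z\<close>.

  The set \<open>S\<close> is rigid. It is a union of cosets of \<open>Z \<inter> H\<close>, because this group
  fixes all points, and it contains at most one such coset inside each coset of \<open>Z\<close>, because two
  intersecting elements can differ by a central factor only if this factor lies in \<open>H\<close>. Moreover
  \<open>S \<subseteq> H Z s\<close> for every \<open>s \<in> S\<close>. As \<open>H\<close> itself is intersecting, \<open>S\<close> has at least \<open>|H|\<close> elements,
  and counting gives \<open>S Z = H Z s\<close> (\<open>S_mult_center_eq_coset\<close>). It follows that \<open>H\<close> acts on
  \<open>S\<close> up to conjugation: for \<open>s \<in> S\<close> and \<open>h \<in> H\<close> some conjugate of \<open>h\<close> moves \<open>s\<close> into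
  \<open>S\<close> (\<open>conjugate_translate_in_S\<close>).

  Summing the left translates of a function \<open>w\<close> by all elements \<open>g h g\<^sup>-\<^sup>1\<close>, with \<open>g \<in> G\<close> and
  \<open>h \<in> H\<close>, gives a canonical combination: for fixed \<open>g\<close> the sum over \<open>h\<close> is left invariant under
  the stabilizer of \<open>g\<alpha>\<close>. Call this operator \<open>T\<close>. Consider the functions supported on \<open>S Z\<close> whose
  value at \<open>s z\<close> does not depend on \<open>s \<in> S\<close>; the characteristic vector of \<open>S\<close> is one of them. On
  these functions \<open>T = |G| \<Sum>\<^sub>h E\<^sub>h\<close>, where \<open>E\<^sub>h\<close> is the average over the right translations by
  the elements of the subgroup \<open>{[h, g] | g \<in> G}\<close> of \<open>Z\<close> (\<open>sum_conjugate_translates\<close>).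

  The \<open>E\<^sub>h\<close> are commuting idempotents and \<open>E\<^sub>1\<close> is the identity. On a common eigenvector of
  all \<open>E\<^sub>h\<close> the operator \<open>T\<close> is therefore multiplication by \<open>|G| n\<close> with \<open>n \<ge> 1\<close>, so that the
  eigenvector is itself a canonical combination. Every function in the space is a sum of common
  eigenvectors (\<open>commuting_idempotents_induct\<close>), in particular the characteristic vector of \<open>S\<close>.
\<close>

section \<open>Commuting idempotents\<close>

text \<open>
  Splitting \<open>w = e\<^sub>j w + (w - e\<^sub>j w)\<close> for one \<open>j\<close> after the other writes every \<open>w\<close> as a sum of
  common eigenvectors, since the other operators commute with \<open>e\<^sub>j\<close> and so respect both parts.
  The rule is this decomposition in the form of an induction for an additive property \<open>Q\<close>.
\<close>

lemma commuting_idempotents_induct: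
  fixes e :: "'i \<Rightarrow> 'v \<Rightarrow> 'v::ab_group_add"
  assumes "finite J"
    and closed: "\<And>j w. j \<in> J \<Longrightarrow> w \<in> W \<Longrightarrow> e j w \<in> W"
    and diff_closed: "\<And>u v. u \<in> W \<Longrightarrow> v \<in> W \<Longrightarrow> u - v \<in> W"
    and diff: "\<And>j u v. j \<in> J \<Longrightarrow> u \<in> W \<Longrightarrow> v \<in> W \<Longrightarrow> e j (u - v) = e j u - e j v"
    and idem: "\<And>j w. j \<in> J \<Longrightarrow> w \<in> W \<Longrightarrow> e j (e j w) = e j w"
    and commute: "\<And>i j w. i \<in> J \<Longrightarrow> j \<in> J \<Longrightarrow> w \<in> W \<Longrightarrow> e i (e j w) = e j (e i w)"
    and eigen: "\<And>w. w \<in> W \<Longrightarrow> (\<And>j. j \<in> J \<Longrightarrow> e j w = 0 \<or> e j w = w) \<Longrightarrow> Q w"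
    and add: "\<And>u v. Q u \<Longrightarrow> Q v \<Longrightarrow> Q (u + v)"
    and "w \<in> W"
  shows "Q w"
proof -
  \<comment> \<open>\<open>I\<close> collects the indices for which \<open>w\<close> is not yet known to be an eigenvector.\<close>
  have "Q w" if "finite I" "I \<subseteq> J" "w \<in> W" "\<And>j. j \<in> J - I \<Longrightarrow> e j w = 0 \<or> e j w = w" for I w
    using that
  proof (induction I arbitrary: w)
    case empty
    then show ?case by (intro eigen) auto
  next
    case (insert i I)
    have i: "i \<in> J" "e i w \<in> W" "w - e i w \<in> W"
      using insert.prems closed diff_closed by auto
    have "Q (e i w)"
    proof (rule insert.IH)
      fix j assume j: "j \<in> J - I"
      show "e j (e i w) = 0 \<or> e j (e i w) = e i w"
      proof (cases "j = i")
        case True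
        then show ?thesis using idem i insert.prems by auto
      next
        case False
        have "e i 0 = 0" using diff[of i w w] i insert.prems by simp
        moreover have "e j w = 0 \<or> e j w = w" using insert.prems(3)[of j] j False by auto
        ultimately show ?thesis using insert.prems j commute[of j i w] i by auto
      qed
    qed (use insert.prems i in auto)
    moreover have "Q (w - e i w)"
    proof (rule insert.IH)
      fix j assume j: "j \<in> J - I"
      have *: "e j (w - e i w) = e j w - e j (e i w)"
        using diff j i insert.prems by auto
      show "e j (w - e i w) = 0 \<or> e j (w - e i w) = w - e i w"
      proof (cases "j = i")
        case True
        then show ?thesis using * idem i insert.prems by auto
      next
        case False
        have "e i 0 = 0" using diff[of i w w] i insert.prems by simp
        moreover have "e j w = 0 \<or> e j w = w" using insert.prems(3)[of j] j False by auto
        ultimately show ?thesis using insert.prems j commute[of j i w] i * by auto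
      qed
    qed (use insert.prems i in auto)
    ultimately have "Q (e i w + (w - e i w))" by (rule add)
    then show ?case by simp
  qed
  from this[of J w] show ?thesis using assms by auto
qed

section \<open>Canonical combinations\<close>

lemma canonical_combinationI:
  assumes "finite P" "P \<subseteq> \<Omega> \<times> \<Omega>"
    and "\<And>g. v g = (\<Sum>(\<alpha>, \<beta>)\<in>P. c \<alpha> \<beta> * canonical_vector G \<phi> \<alpha> \<beta> g)"
  shows "canonical_combination G \<Omega> \<phi> v"
  unfolding canonical_combination_def
  by (rule exI[of _ P], rule exI[of _ c]) (simp add: assms fun_eq_iff)

text \<open>
  Taking \<open>\<Omega> \<times> \<Omega>\<close> as the index set of every combination makes coefficients addable.
\<close>

lemma canonical_combinationE:
  assumes "finite \<Omega>" "canonical_combination G \<Omega> \<phi> v"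
  obtains c where
    "v = (\<lambda>g. \<Sum>(\<alpha>, \<beta>)\<in>\<Omega> \<times> \<Omega>. c \<alpha> \<beta> * canonical_vector G \<phi> \<alpha> \<beta> g)"
proof -
  obtain P c where P: "finite P" "P \<subseteq> \<Omega> \<times> \<Omega>"
    and v: "v = (\<lambda>g. \<Sum>(\<alpha>, \<beta>)\<in>P. c \<alpha> \<beta> * canonical_vector G \<phi> \<alpha> \<beta> g)"
    using assms(2) unfolding canonical_combination_def by (elim exE conjE)
  define d where "d \<alpha> \<beta> = (if (\<alpha>, \<beta>) \<in> P then c \<alpha> \<beta> else 0)" for \<alpha> \<beta>
  have "v = (\<lambda>g. \<Sum>(\<alpha>, \<beta>)\<in>\<Omega> \<times> \<Omega>. d \<alpha> \<beta> * canonical_vector G \<phi> \<alpha> \<beta> g)"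
    unfolding v using P assms(1)
    by (intro ext sum.mono_neutral_cong_left) (auto simp: d_def)
  then show ?thesis by (rule that)
qed

lemma canonical_combination_add:
  assumes "finite \<Omega>" "canonical_combination G \<Omega> \<phi> u" "canonical_combination G \<Omega> \<phi> v"
  shows "canonical_combination G \<Omega> \<phi> (u + v)"
proof -
  obtain c where c: "u = (\<lambda>g. \<Sum>(\<alpha>, \<beta>)\<in>\<Omega> \<times> \<Omega>. c \<alpha> \<beta> * canonical_vector G \<phi> \<alpha> \<beta> g)"
    by (rule canonical_combinationE[OF assms(1,2)])
  obtain d where d: "v = (\<lambda>g. \<Sum>(\<alpha>, \<beta>)\<in>\<Omega> \<times> \<Omega>. d \<alpha> \<beta> * canonical_vector G \<phi> \<alpha> \<beta> g)"
    by (rule canonical_combinationE[OF assms(1,3)])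
  show ?thesis
    by (rule canonical_combinationI[where P = "\<Omega> \<times> \<Omega>" and c = "\<lambda>\<alpha> \<beta>. c \<alpha> \<beta> + d \<alpha> \<beta>"])
       (auto simp: assms(1) c d sum.distrib[symmetric] distrib_right intro!: sum.cong)
qed

lemma canonical_combination_scale:
  assumes "finite \<Omega>" "canonical_combination G \<Omega> \<phi> v"
  shows "canonical_combination G \<Omega> \<phi> (\<lambda>x. a * v x)"
proof -
  obtain c where c: "v = (\<lambda>g. \<Sum>(\<alpha>, \<beta>)\<in>\<Omega> \<times> \<Omega>. c \<alpha> \<beta> * canonical_vector G \<phi> \<alpha> \<beta> g)"
    by (rule canonical_combinationE[OF assms])
  show ?thesis
    by (rule canonical_combinationI[where P = "\<Omega> \<times> \<Omega>" and c = "\<lambda>\<alpha> \<beta>. a * c \<alpha> \<beta>"])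
       (auto simp: assms(1) c sum_distrib_left mult.assoc intro!: sum.cong)
qed

lemma canonical_combination_sum:
  assumes "finite \<Omega>" "finite I" "\<And>i. i \<in> I \<Longrightarrow> canonical_combination G \<Omega> \<phi> (v i)"
  shows "canonical_combination G \<Omega> \<phi> (\<lambda>x. \<Sum>i\<in>I. v i x)"
  using assms(2,3)
proof (induction I)
  case empty
  show ?case by (rule canonical_combinationI[of "{}"]) auto
next
  case (insert i I)
  then have "canonical_combination G \<Omega> \<phi> (v i)" "canonical_combination G \<Omega> \<phi> (\<lambda>x. \<Sum>i\<in>I. v i x)"
    by auto
  then have "canonical_combination G \<Omega> \<phi> (v i + (\<lambda>x. \<Sum>i\<in>I. v i x))"
    by (rule canonical_combination_add[OF assms(1)])
  then show ?case using insert by (simp add: plus_fun_def)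
qed

lemma (in transitive_action) finite_points:
  assumes "finite (carrier G)"
  shows "finite E"
proof (cases "E = {}")
  case False
  then obtain x where "x \<in> E" by blast
  then have "E \<subseteq> (\<lambda>g. \<phi> g x) ` carrier G"
    using unique_orbit by blast
  then show ?thesis using assms by (meson finite_surj)
qed auto

text \<open>
  The sets \<open>{t. \<phi> t \<gamma> = \<beta>}\<close> with \<open>\<beta>\<close> fixed and \<open>\<gamma>\<close> varying are exactly the right cosets of the
  stabilizer of \<open>\<beta>\<close>, so left invariance makes \<open>v\<close> constant on each of them.
\<close>

lemma (in transitive_action) canonical_combination_if_left_invariant:
  assumes fin: "finite (carrier G)" and \<beta>: "\<beta> \<in> E"
    and supp: "\<And>x. x \<notin> carrier G \<Longrightarrow> v x = 0"
    and inv: "\<And>k x. k \<in> stabilizer G \<phi> \<beta> \<Longrightarrow> x \<in> carrier G \<Longrightarrow> v (k \<otimes> x) = v x"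
  shows "canonical_combination G E \<phi> v"
proof -
  interpret group G using group_hom group_hom.axioms(1) by auto
  \<comment> \<open>The coefficient at \<open>(\<gamma>, \<beta>)\<close> is the common value of \<open>v\<close> on the elements carrying \<open>\<gamma>\<close> to \<open>\<beta>\<close>.\<close>
  define c where "c \<gamma> \<delta> = v (SOME x. x \<in> carrier G \<and> \<phi> x \<gamma> = \<delta>)" for \<gamma> \<delta>
  have c: "c \<gamma> \<beta> = v x" if x: "x \<in> carrier G" "\<phi> x \<gamma> = \<beta>" "\<gamma> \<in> E" for x \<gamma>
  proof -
    define y where "y = (SOME x. x \<in> carrier G \<and> \<phi> x \<gamma> = \<beta>)"
    have y: "y \<in> carrier G" "\<phi> y \<gamma> = \<beta>"
      using someI[of "\<lambda>x. x \<in> carrier G \<and> \<phi> x \<gamma> = \<beta>" x] x unfolding y_def by auto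
    have "\<phi> (x \<otimes> inv y) \<beta> = \<beta>"
      using composition_rule[OF \<beta>, of x "inv y"] orbit_sym_aux[OF y(1) x(3) y(2)] x y by simp
    then have "v (x \<otimes> inv y \<otimes> y) = v y"
      using x y by (intro inv) (auto simp: stabilizer_def)
    then show ?thesis using x y by (simp add: c_def y_def[symmetric] m_assoc)
  qed
  have "v x = (\<Sum>(\<gamma>, \<delta>)\<in>E \<times> {\<beta>}. c \<gamma> \<delta> * canonical_vector G \<phi> \<gamma> \<delta> x)" for x
  proof -
    have "(\<Sum>(\<gamma>, \<delta>)\<in>E \<times> {\<beta>}. c \<gamma> \<delta> * canonical_vector G \<phi> \<gamma> \<delta> x)
        = (\<Sum>\<gamma>\<in>E. c \<gamma> \<beta> * canonical_vector G \<phi> \<gamma> \<beta> x)"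
      using finite_points[OF fin] by (subst sum.cartesian_product[symmetric]) simp
    also have "\<dots> = v x"
    proof (cases "x \<in> carrier G")
      case False
      then show ?thesis by (simp add: supp canonical_vector_def char_vector_def)
    next
      case True
      define \<gamma> where "\<gamma> = \<phi> (inv x) \<beta>"
      have \<gamma>: "\<gamma> \<in> E" "\<phi> x \<gamma> = \<beta>"
        using True \<beta> element_image[of "inv x" \<beta>] orbit_sym_aux[of "inv x" \<beta> \<gamma>]
        by (auto simp: \<gamma>_def)
      have "\<phi> x \<gamma>' = \<beta> \<longleftrightarrow> \<gamma>' = \<gamma>" if "\<gamma>' \<in> E" for \<gamma>'
        using bij_prop1[OF True \<beta>] \<gamma> that by blast
      then have "(\<Sum>\<gamma>\<in>E. c \<gamma> \<beta> * canonical_vector G \<phi> \<gamma> \<beta> x)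
          = (\<Sum>\<gamma>'\<in>E. if \<gamma>' = \<gamma> then v x else 0)"
        using c[OF True] \<gamma> True
        by (intro sum.cong) (auto simp: canonical_vector_def char_vector_def)
      then show ?thesis using \<gamma> finite_points[OF fin] by simp
    qed
    finally show ?thesis by simp
  qed
  then show ?thesis
    by (rule canonical_combinationI[rotated 2]) (use finite_points[OF fin] \<beta> in auto)
qed

section \<open>Groups with central commutators\<close>

definition center :: "('a, 'm) monoid_scheme \<Rightarrow> 'a set" where
  "center G = {z \<in> carrier G. \<forall>x\<in>carrier G. z \<otimes>\<^bsub>G\<^esub> x = x \<otimes>\<^bsub>G\<^esub> z}"

definition commutator :: "('a, 'm) monoid_scheme \<Rightarrow> 'a \<Rightarrow> 'a \<Rightarrow> 'a" where
  "commutator G x y = x \<otimes>\<^bsub>G\<^esub> y \<otimes>\<^bsub>G\<^esub> inv\<^bsub>G\<^esub> x \<otimes>\<^bsub>G\<^esub> inv\<^bsub>G\<^esub> y"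

lemma (in group) center_carrier [simp, intro]: "z \<in> center G \<Longrightarrow> z \<in> carrier G"
  by (simp add: center_def)

lemma (in group) center_commute: "z \<in> center G \<Longrightarrow> x \<in> carrier G \<Longrightarrow> z \<otimes> x = x \<otimes> z"
  unfolding center_def by blast

lemma (in group) inv_mult_left_cancel:
  "x \<in> carrier G \<Longrightarrow> y \<in> carrier G \<Longrightarrow> inv x \<otimes> (x \<otimes> y) = y"
  "x \<in> carrier G \<Longrightarrow> y \<in> carrier G \<Longrightarrow> x \<otimes> (inv x \<otimes> y) = y"
  by (simp_all add: m_assoc[symmetric])

lemma (in group) subgroup_center: "subgroup (center G) G"
proof (rule subgroupI)
  fix a assume a: "a \<in> center G"
  have "inv a \<otimes> x = x \<otimes> inv a" if x: "x \<in> carrier G" for x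
  proof -
    have "inv a \<otimes> x = inv a \<otimes> (x \<otimes> a) \<otimes> inv a"
      using a x by (simp add: m_assoc)
    also have "\<dots> = x \<otimes> inv a"
      using a x by (simp add: center_commute[symmetric] m_assoc inv_mult_left_cancel)
    finally show ?thesis .
  qed
  moreover have "inv a \<in> carrier G" using a by simp
  ultimately show "inv a \<in> center G" unfolding center_def by blast
next
  fix a b assume ab: "a \<in> center G" "b \<in> center G"
  have "a \<otimes> b \<otimes> x = x \<otimes> (a \<otimes> b)" if x: "x \<in> carrier G" for x
  proof -
    have "a \<otimes> b \<otimes> x = a \<otimes> x \<otimes> b"
      using ab x by (simp add: m_assoc center_commute[of b x])
    also have "\<dots> = x \<otimes> (a \<otimes> b)"
      using ab x by (simp add: center_commute[of a x] m_assoc)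
    finally show ?thesis .
  qed
  moreover have "a \<otimes> b \<in> carrier G" using ab by simp
  ultimately show "a \<otimes> b \<in> center G" unfolding center_def by blast
next
  have "\<one> \<in> center G" unfolding center_def by simp
  then show "center G \<noteq> {}" by blast
next
  show "center G \<subseteq> carrier G" by blast
qed

lemma (in group) center_left_commute:
  "z \<in> center G \<Longrightarrow> x \<in> carrier G \<Longrightarrow> y \<in> carrier G \<Longrightarrow> x \<otimes> (z \<otimes> y) = z \<otimes> (x \<otimes> y)"
  by (metis center_carrier center_commute m_assoc)

text \<open>
  The multiplication map \<open>A \<times> Z \<rightarrow> A Z\<close> has all fibres of size \<open>|K|\<close>: the pairs with the same
  product as \<open>(a, z)\<close> are the pairs \<open>(a k, k\<^sup>-\<^sup>1 z)\<close> with \<open>k \<in> K\<close>. The factor \<open>A\<close>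
  will be a point stabilizer in one application and an intersecting set in the other.
\<close>

lemma (in group) card_set_mult_subgroup:
  assumes fin: "finite (carrier G)" and A: "A \<subseteq> carrier G" and Z: "subgroup Z G"
    and K: "K \<subseteq> Z"
    and period: "\<And>a z. a \<in> A \<Longrightarrow> z \<in> Z \<Longrightarrow> a \<otimes> z \<in> A \<longleftrightarrow> z \<in> K"
  shows "card (A <#> Z) * card K = card A * card Z"
proof -
  have Zc: "z \<in> carrier G" if "z \<in> Z" for z using subgroup.mem_carrier[OF Z that] .
  have Ac: "a \<in> carrier G" if "a \<in> A" for a using A that by blast
  have fins: "finite A" "finite Z"
    using A Zc fin by (auto intro: finite_subset[OF _ fin])
  define F where "F y = {p \<in> A \<times> Z. fst p \<otimes> snd p = y}" for y
  have fibre: "card (F y) = card K" if "y \<in> A <#> Z" for y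
  proof -
    obtain a z where az: "a \<in> A" "z \<in> Z" "y = a \<otimes> z"
      using \<open>y \<in> A <#> Z\<close> by (auto simp: set_mult_def)
    have "bij_betw (\<lambda>k. (a \<otimes> k, inv k \<otimes> z)) K (F y)"
    proof (rule bij_betwI[where g = "\<lambda>p. inv a \<otimes> fst p"])
      show "(\<lambda>k. (a \<otimes> k, inv k \<otimes> z)) \<in> K \<rightarrow> F y"
        using az K period subgroup.m_closed[OF Z] subgroup.m_inv_closed[OF Z] Zc Ac
        by (auto simp: F_def m_assoc inv_mult_left_cancel subset_iff)
      show "(\<lambda>p. inv a \<otimes> fst p) \<in> F y \<rightarrow> K"
      proof
        fix p assume p: "p \<in> F y"
        then have p': "fst p \<in> A" "snd p \<in> Z" "fst p \<otimes> snd p = a \<otimes> z"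
          using az by (auto simp: F_def)
        have "fst p = a \<otimes> (z \<otimes> inv (snd p))"
          using p' az Zc Ac by (metis inv_solve_right m_assoc m_closed inv_closed)
        moreover have "z \<otimes> inv (snd p) \<in> Z"
          using az p' subgroup.m_closed[OF Z] subgroup.m_inv_closed[OF Z] by auto
        ultimately show "inv a \<otimes> fst p \<in> K"
          using period[of a "z \<otimes> inv (snd p)"] p' az Zc Ac by (simp add: inv_mult_left_cancel)
      qed
      show "inv a \<otimes> fst (a \<otimes> k, inv k \<otimes> z) = k" if "k \<in> K" for k
        using that K Zc Ac az by (auto simp: inv_mult_left_cancel)
      show "(a \<otimes> (inv a \<otimes> fst p), inv (inv a \<otimes> fst p) \<otimes> z) = p" if p: "p \<in> F y" for p
      proof -
        have p': "fst p \<in> A" "snd p \<in> Z" "fst p \<otimes> snd p = a \<otimes> z"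
          using p az by (auto simp: F_def)
        then show ?thesis using az Zc Ac
          by (auto simp: inv_mult_left_cancel inv_mult_group m_assoc prod_eq_iff)
             (metis inv_mult_left_cancel(1))
      qed
    qed
    then show ?thesis by (simp add: bij_betw_same_card)
  qed
  have "A \<times> Z = (\<Union>y\<in>A <#> Z. F y)" by (force simp: F_def set_mult_def)
  then have "card A * card Z = card (\<Union>y\<in>A <#> Z. F y)"
    by (simp add: card_cartesian_product[symmetric])
  also have "\<dots> = (\<Sum>y\<in>A <#> Z. card (F y))"
    using fins by (intro card_UN_disjoint) (auto simp: F_def set_mult_def)
  also have "\<dots> = card (A <#> Z) * card K" using fibre by simp
  finally show ?thesis by simp
qed

locale class_two_group = group +
  assumes commutator_center: "x \<in> carrier G \<Longrightarrow> y \<in> carrier G \<Longrightarrow> commutator G x y \<in> center G"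
begin

lemma commutator_closed [simp, intro]:
  "x \<in> carrier G \<Longrightarrow> y \<in> carrier G \<Longrightarrow> commutator G x y \<in> carrier G"
  by (simp add: commutator_def)

lemma commutator_mult_right:
  assumes "h \<in> carrier G" "x \<in> carrier G" "y \<in> carrier G"
  shows "commutator G h (x \<otimes> y) = commutator G h x \<otimes> commutator G h y"
proof -
  have "commutator G h (x \<otimes> y) = h \<otimes> x \<otimes> inv h \<otimes> commutator G h y \<otimes> inv x"
    using assms by (simp add: commutator_def m_assoc inv_mult_group inv_mult_left_cancel)
  also have "\<dots> = h \<otimes> x \<otimes> inv h \<otimes> (commutator G h y \<otimes> inv x)"
    using assms by (simp add: m_assoc)
  also have "commutator G h y \<otimes> inv x = inv x \<otimes> commutator G h y"
    using assms by (intro center_commute commutator_center) auto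
  also have "h \<otimes> x \<otimes> inv h \<otimes> (inv x \<otimes> commutator G h y) = commutator G h x \<otimes> commutator G h y"
    using assms by (simp add: commutator_def m_assoc)
  finally show ?thesis .
qed

lemma conjugate_eq:
  assumes "h \<in> carrier G" "g \<in> carrier G"
  shows "g \<otimes> h \<otimes> inv g = inv (commutator G h g) \<otimes> h"
  using assms by (simp add: commutator_def m_assoc inv_mult_group inv_mult_left_cancel)

text \<open>
  All conjugates of \<open>h\<close> agree up to the central factors \<open>[h, g]\<close>. As \<open>x\<close> runs through the group,
  so does \<open>x\<^sup>-\<^sup>1 y\<close>; a sum over the conjugates of \<open>h\<close> thus becomes a sum over these factors.
\<close>

lemma conjugates_differ_by_commutator:
  assumes h: "h \<in> carrier G" and x: "x \<in> carrier G" and y: "y \<in> carrier G"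
  shows "x \<otimes> h \<otimes> inv x = y \<otimes> h \<otimes> inv y \<otimes> commutator G h (inv x \<otimes> y)"
proof -
  have "commutator G h x \<otimes> commutator G h (inv x \<otimes> y) = commutator G h y"
    using commutator_mult_right[of h x "inv x \<otimes> y"] assms
    by (simp add: inv_mult_left_cancel)
  then have *: "commutator G h (inv x \<otimes> y) = inv (commutator G h x) \<otimes> commutator G h y"
    using assms by (metis commutator_closed inv_closed inv_mult_left_cancel(1) m_closed)
  have "y \<otimes> h \<otimes> inv y \<otimes> commutator G h (inv x \<otimes> y)
      = commutator G h (inv x \<otimes> y) \<otimes> (y \<otimes> h \<otimes> inv y)"
    using assms by (intro center_commute[symmetric] commutator_center) auto
  also have "\<dots> = inv (commutator G h x) \<otimes> h"
    using assms by (simp only: * conjugate_eq) (simp add: m_assoc inv_mult_left_cancel)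
  finally show ?thesis using assms by (simp add: conjugate_eq)
qed

end

section \<open>Averaging over commutator subgroups\<close>

text \<open>
  In a finite group with central commutators the elements \<open>[h, g]\<close>, for fixed \<open>h\<close>, form a subgroup
  of the center, and each of them occurs equally often as \<open>g\<close> varies; the average over \<open>g\<close> is therefore the projection to the functions invariant under this subgroup.
\<close>

definition commutator_average :: "('a, 'm) monoid_scheme \<Rightarrow> 'a \<Rightarrow> ('a \<Rightarrow> complex) \<Rightarrow> 'a \<Rightarrow> complex" where
  "commutator_average G h w x =
     (if x \<in> carrier G
      then (\<Sum>g\<in>carrier G. w (x \<otimes>\<^bsub>G\<^esub> commutator G h g)) / of_nat (card (carrier G)) else 0)"

context class_two_group
begin

lemma commutator_average_diff:
  "commutator_average G h (u - v) = commutator_average G h u - commutator_average G h v"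
  by (auto simp: commutator_average_def fun_eq_iff sum_subtractf diff_divide_distrib)

lemma sum_carrier_mult_left:
  assumes "a \<in> carrier G"
  shows "(\<Sum>g\<in>carrier G. f (a \<otimes> g)) = (\<Sum>g\<in>carrier G. f g)"
  by (rule sum.reindex_bij_witness[where i = "\<lambda>g. inv a \<otimes> g" and j = "\<lambda>g. a \<otimes> g"])
     (use assms in \<open>auto simp: inv_mult_left_cancel\<close>)

lemma sum_carrier_inv_mult:
  assumes "a \<in> carrier G"
  shows "(\<Sum>g\<in>carrier G. f (inv g \<otimes> a)) = (\<Sum>g\<in>carrier G. f g)"
  by (rule sum.reindex_bij_witness[where i = "\<lambda>g. a \<otimes> inv g" and j = "\<lambda>g. inv g \<otimes> a"])
     (use assms in \<open>auto simp: inv_mult_left_cancel inv_mult_group m_assoc\<close>)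

lemma commutator_average_invariant:
  assumes "h \<in> carrier G" "g \<in> carrier G" "x \<in> carrier G"
  shows "commutator_average G h w (x \<otimes> commutator G h g) = commutator_average G h w x"
  using sum_carrier_mult_left[of g "\<lambda>g. w (x \<otimes> commutator G h g)"] assms
  by (simp add: commutator_average_def m_assoc commutator_mult_right[symmetric])

lemma commutator_average_idem:
  assumes fin: "finite (carrier G)" and h: "h \<in> carrier G"
  shows "commutator_average G h (commutator_average G h w) = commutator_average G h w"
proof
  fix x
  have "card (carrier G) \<noteq> 0" using fin by (metis card_0_eq empty_iff one_closed)
  then show "commutator_average G h (commutator_average G h w) x = commutator_average G h w x"
    using commutator_average_invariant[OF h, of _ x w]
    by (cases "x \<in> carrier G")
       (simp_all add: commutator_average_def[of G h "commutator_average G h w"]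
          commutator_average_def[of G h w x])
qed

lemma commutator_average_commute:
  assumes "h \<in> carrier G" "k \<in> carrier G"
  shows "commutator_average G h (commutator_average G k w)
       = commutator_average G k (commutator_average G h w)"
proof
  fix x
  show "commutator_average G h (commutator_average G k w) x
      = commutator_average G k (commutator_average G h w) x"
  proof (cases "x \<in> carrier G")
    case True
    let ?n = "of_nat (card (carrier G)) :: complex"
    have expand: "commutator_average G a (commutator_average G b w) x
        = (\<Sum>g\<in>carrier G. \<Sum>g'\<in>carrier G. w (x \<otimes> commutator G a g \<otimes> commutator G b g')) / (?n * ?n)"
      if "a \<in> carrier G" "b \<in> carrier G" for a b
      using True that by (simp add: commutator_average_def sum_divide_distrib)
    have "commutator G h g \<otimes> commutator G k g' = commutator G k g' \<otimes> commutator G h g"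
      if "g \<in> carrier G" "g' \<in> carrier G" for g g'
      using that assms by (intro center_commute commutator_center) auto
    then show ?thesis
      unfolding expand[OF assms] expand[OF assms(2,1)]
      using assms True by (subst sum.swap) (simp add: m_assoc)
  qed (simp add: commutator_average_def)
qed

lemma commutator_average_one:
  assumes "finite (carrier G)" "\<And>x. x \<notin> carrier G \<Longrightarrow> w x = 0"
  shows "commutator_average G \<one> w = w"
proof -
  have "card (carrier G) \<noteq> 0" using assms by (metis card_0_eq empty_iff one_closed)
  then show ?thesis using assms(2)
    by (auto simp: commutator_average_def commutator_def fun_eq_iff)
qed

end

section \<open>Maximum intersecting sets modulo the center\<close>

locale class_two_maximum_intersecting =
  class_two_group G + transitive_action G \<Omega> \<phi> for G (structure) and \<Omega> and \<phi> +
  fixes \<alpha> S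
  assumes finite_carrier: "finite (carrier G)"
    and point: "\<alpha> \<in> \<Omega>"
    and maximum: "maximum_intersecting_set G \<Omega> \<phi> S"
begin

abbreviation H where "H \<equiv> stabilizer G \<phi> \<alpha>"
abbreviation Z where "Z \<equiv> center G"

lemma S_carrier [simp, intro]: "s \<in> S \<Longrightarrow> s \<in> carrier G"
  using maximum by (auto simp: maximum_intersecting_set_def intersecting_set_def)

lemma H_carrier [simp, intro]: "h \<in> H \<Longrightarrow> h \<in> carrier G"
  by (simp add: stabilizer_def)

lemma H_subgroup: "subgroup H G"
  using stabilizer_subgroup point .

lemma finite_H: "finite H"
  by (auto intro: finite_subset[OF _ finite_carrier])

lemma conjugate_fixes_iff:
  assumes "g \<in> carrier G" "x \<in> carrier G"
  shows "\<phi> x (\<phi> g \<alpha>) = \<phi> g \<alpha> \<longleftrightarrow> inv g \<otimes> x \<otimes> g \<in> H"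
proof -
  have g\<alpha>: "\<phi> g \<alpha> \<in> \<Omega>" using element_image assms point by blast
  have comp: "\<phi> (inv g \<otimes> x \<otimes> g) \<alpha> = \<phi> (inv g) (\<phi> x (\<phi> g \<alpha>))"
    using assms point g\<alpha> by (simp add: composition_rule)
  have "\<phi> (inv g) (\<phi> x (\<phi> g \<alpha>)) = \<alpha> \<longleftrightarrow> \<phi> x (\<phi> g \<alpha>) = \<phi> g \<alpha>"
  proof
    assume "\<phi> (inv g) (\<phi> x (\<phi> g \<alpha>)) = \<alpha>"
    then show "\<phi> x (\<phi> g \<alpha>) = \<phi> g \<alpha>"
      using orbit_sym_aux[of "inv g" "\<phi> x (\<phi> g \<alpha>)" \<alpha>] assms element_image[OF assms(2) g\<alpha>] by simp
  next
    assume "\<phi> x (\<phi> g \<alpha>) = \<phi> g \<alpha>"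
    then show "\<phi> (inv g) (\<phi> x (\<phi> g \<alpha>)) = \<alpha>"
      using orbit_sym_aux[OF assms(1) point refl] by simp
  qed
  then show ?thesis
    unfolding comp[symmetric] using assms by (simp add: stabilizer_def del: H_carrier)
qed

lemma intersects_iff:
  assumes "x \<in> carrier G" "y \<in> carrier G"
  shows "intersects G \<Omega> \<phi> x y \<longleftrightarrow> (\<exists>g\<in>carrier G. inv g \<otimes> (x \<otimes> inv y) \<otimes> g \<in> H)"
proof -
  have "\<Omega> = (\<lambda>g. \<phi> g \<alpha>) ` carrier G"
    using unique_orbit[OF point] element_image[OF _ point] by blast
  then have "intersects G \<Omega> \<phi> x y \<longleftrightarrow> (\<exists>g\<in>carrier G. \<phi> (x \<otimes> inv y) (\<phi> g \<alpha>) = \<phi> g \<alpha>)"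
    by (auto simp: intersects_def)
  then show ?thesis using conjugate_fixes_iff assms by auto
qed

lemma S_intersects: "s \<in> S \<Longrightarrow> t \<in> S \<Longrightarrow> intersects G \<Omega> \<phi> s t"
  using maximum by (auto simp: maximum_intersecting_set_def intersecting_set_def)

lemma H_intersecting: "intersecting_set G \<Omega> \<phi> H"
  unfolding intersecting_set_def intersects_def
proof (intro conjI ballI)
  show "H \<subseteq> carrier G" by (rule stabilizer_subset)
  fix \<sigma> \<tau> assume "\<sigma> \<in> H" "\<tau> \<in> H"
  then have "\<sigma> \<otimes> inv \<tau> \<in> H"
    using subgroup.m_closed[OF H_subgroup] subgroup.m_inv_closed[OF H_subgroup] by blast
  then have "\<phi> (\<sigma> \<otimes> inv \<tau>) \<alpha> = \<alpha>" unfolding stabilizer_def by blast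
  then show "\<exists>\<omega>\<in>\<Omega>. \<phi> (\<sigma> \<otimes> inv \<tau>) \<omega> = \<omega>" using point by blast
qed

lemma card_H_le: "card H \<le> card S"
  using maximum H_intersecting by (auto simp: maximum_intersecting_set_def)

text \<open>
  Central elements of \<open>H\<close> fix every point, so multiplying by them does not affect whether two
  elements intersect. Hence \<open>S (Z \<inter> H)\<close> is intersecting too, and it equals \<open>S\<close> by maximality.
\<close>

lemma S_mult_central_stabilizer:
  assumes s: "s \<in> S" and z: "z \<in> Z \<inter> H"
  shows "s \<otimes> z \<in> S"
proof -
  have Z0: "subgroup (Z \<inter> H) G"
    using subgroup_center H_subgroup by (rule subgroups_Inter_pair)
  let ?S = "S <#> (Z \<inter> H)"
  have sub: "?S \<subseteq> carrier G" by (auto simp: set_mult_def)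
  have "intersects G \<Omega> \<phi> x y" if xy_in: "x \<in> ?S" "y \<in> ?S" for x y
  proof -
    obtain a b c d where abcd: "a \<in> S" "b \<in> Z \<inter> H" "c \<in> S" "d \<in> Z \<inter> H"
      and xy: "x = a \<otimes> b" "y = c \<otimes> d"
      using xy_in unfolding set_mult_def by blast
    let ?z = "b \<otimes> inv d"
    have z: "?z \<in> Z \<inter> H"
      using abcd subgroup.m_closed[OF Z0] subgroup.m_inv_closed[OF Z0] by blast
    obtain g where g: "g \<in> carrier G" "inv g \<otimes> (a \<otimes> inv c) \<otimes> g \<in> H"
      using S_intersects[of a c] intersects_iff abcd by blast
    have "x \<otimes> inv y = a \<otimes> (?z \<otimes> inv c)"
      using abcd xy by (simp add: m_assoc inv_mult_group)
    also have "\<dots> = a \<otimes> inv c \<otimes> ?z"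
      using abcd z center_commute[of ?z "inv c"] by (simp add: m_assoc)
    finally have xy': "x \<otimes> inv y = a \<otimes> inv c \<otimes> ?z" .
    have zg: "?z \<otimes> g = g \<otimes> ?z"
      using z g by (intro center_commute) auto
    have "inv g \<otimes> (a \<otimes> inv c \<otimes> ?z) \<otimes> g = inv g \<otimes> (a \<otimes> inv c) \<otimes> (?z \<otimes> g)"
      using abcd g by (simp add: m_assoc)
    also have "\<dots> = inv g \<otimes> (a \<otimes> inv c) \<otimes> g \<otimes> ?z"
      unfolding zg using abcd g by (simp add: m_assoc)
    finally have "inv g \<otimes> (x \<otimes> inv y) \<otimes> g \<in> H"
      unfolding xy' using g(2) z subgroup.m_closed[OF H_subgroup] by auto
    then show ?thesis using intersects_iff[of x y] xy_in sub g(1) by blast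
  qed
  then have "card ?S \<le> card S"
    using maximum sub by (auto simp: maximum_intersecting_set_def intersecting_set_def)
  moreover have "S \<subseteq> ?S"
    using subgroup.one_closed[OF Z0] by (force simp: set_mult_def)
  moreover have "finite ?S" using sub finite_carrier finite_subset by blast
  ultimately have "S = ?S" by (intro card_subset_eq) (auto dest: card_mono)
  then show ?thesis using s z by (force simp: set_mult_def)
qed

lemma S_mult_central_iff:
  assumes s: "s \<in> S" and z: "z \<in> Z"
  shows "s \<otimes> z \<in> S \<longleftrightarrow> z \<in> Z \<inter> H"
proof
  assume "s \<otimes> z \<in> S"
  then obtain g where g: "g \<in> carrier G" "inv g \<otimes> (s \<otimes> z \<otimes> inv s) \<otimes> g \<in> H"
    using S_intersects[of "s \<otimes> z" s] intersects_iff s z by blast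
  have "s \<otimes> z \<otimes> inv s = z"
    using s z center_commute[OF z S_carrier[OF s], symmetric] by (simp add: m_assoc)
  moreover have "inv g \<otimes> z \<otimes> g = z"
    using g z by (simp add: center_commute[of z g] m_assoc inv_mult_left_cancel)
  ultimately show "z \<in> Z \<inter> H" using g z by simp
qed (use S_mult_central_stabilizer s in auto)

text \<open>
  The inclusion \<open>S Z \<subseteq> H Z s\<close> holds because conjugates of elements of \<open>H\<close> lie in \<open>H Z\<close>. Equality
  follows by counting: both \<open>|S Z| |Z \<inter> H| = |S| |Z|\<close> and \<open>|H Z| |Z \<inter> H| = |H| |Z|\<close> hold, and
  \<open>|H| \<le> |S|\<close>.
\<close>

lemma S_mult_center_eq_coset:
  assumes s: "s \<in> S"
  shows "S <#> Z = (H <#> Z) #> s"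
proof (rule card_subset_eq)
  have HZ: "H <#> Z \<subseteq> carrier G" by (auto simp: set_mult_def)
  show "finite ((H <#> Z) #> s)"
    using HZ s finite_carrier by (meson S_carrier finite_subset r_coset_subset_G)
  show sub: "S <#> Z \<subseteq> (H <#> Z) #> s"
  proof
    fix y assume "y \<in> S <#> Z"
    then obtain t z where t: "t \<in> S" "z \<in> Z" "y = t \<otimes> z" by (auto simp: set_mult_def)
    obtain g where g: "g \<in> carrier G" "inv g \<otimes> (t \<otimes> inv s) \<otimes> g \<in> H"
      using S_intersects[of t s] intersects_iff s t by blast
    define h where "h = inv g \<otimes> (t \<otimes> inv s) \<otimes> g"
    define c where "c = inv (commutator G h g)"
    have h: "h \<in> H" using g by (simp add: h_def)
    have c: "c \<in> Z"
      using g h unfolding c_def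
      by (intro subgroup.m_inv_closed[OF subgroup_center] commutator_center) auto
    have "t \<otimes> inv s = g \<otimes> h \<otimes> inv g"
      using g s t by (simp add: h_def m_assoc inv_mult_left_cancel)
    also have "\<dots> = c \<otimes> h" using g h unfolding c_def by (intro conjugate_eq) auto
    also have "\<dots> = h \<otimes> c" using c h by (intro center_commute) auto
    finally have "t \<otimes> inv s \<otimes> s = h \<otimes> c \<otimes> s" by simp
    then have "t = h \<otimes> c \<otimes> s" using s t by (simp add: m_assoc)
    then have "y = (h \<otimes> (c \<otimes> z)) \<otimes> s"
      using t s h c center_commute[of z s] by (simp add: m_assoc)
    moreover have "c \<otimes> z \<in> Z" using c t subgroup.m_closed[OF subgroup_center] by blast
    ultimately show "y \<in> (H <#> Z) #> s"
      using h unfolding set_mult_def r_coset_def by blast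
  qed
  have Z0: "card (Z \<inter> H) > 0"
    using subgroup.one_closed[OF H_subgroup] subgroup.one_closed[OF subgroup_center] finite_H
    by (auto simp: card_gt_0_iff)
  have "card (S <#> Z) * card (Z \<inter> H) = card S * card Z"
    using S_mult_central_iff by (intro card_set_mult_subgroup finite_carrier subgroup_center) auto
  moreover have "card (H <#> Z) * card (Z \<inter> H) = card H * card Z"
  proof (intro card_set_mult_subgroup finite_carrier subgroup_center)
    show "h \<otimes> z \<in> H \<longleftrightarrow> z \<in> Z \<inter> H" if "h \<in> H" "z \<in> Z" for h z
      using that subgroup.m_closed[OF H_subgroup] subgroup.m_inv_closed[OF H_subgroup]
      by (metis H_carrier IntE IntI center_carrier inv_mult_left_cancel(1))
  qed auto
  ultimately have "card (H <#> Z) * card (Z \<inter> H) \<le> card (S <#> Z) * card (Z \<inter> H)"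
    using card_H_le by simp
  then have "card (H <#> Z) \<le> card (S <#> Z)" using Z0 by simp
  moreover have "card ((H <#> Z) #> s) = card (H <#> Z)"
    using HZ s card_image[of "\<lambda>x. x \<otimes> s" "H <#> Z"]
    by (simp add: r_coset_def UNION_singleton_eq_range inj_on_def subset_iff)
  ultimately show "card (S <#> Z) = card ((H <#> Z) #> s)"
    using sub card_mono[OF \<open>finite ((H <#> Z) #> s)\<close> sub] by simp
qed

text \<open>
  By \<open>S_mult_center_eq_coset\<close> some \<open>t \<in> S\<close> lies in \<open>h s Z\<close>. It intersects \<open>s\<close>, so \<open>t s\<^sup>-\<^sup>1\<close> is a conjugate
  of some \<open>k \<in> H\<close>, and \<open>h\<close> and \<open>k\<close> differ only by a central element of \<open>H\<close>. The set \<open>S\<close> is closed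
  under such elements, and correcting \<open>t\<close> by this one turns \<open>k\<close> into \<open>h\<close>.
\<close>

lemma conjugate_translate_in_S:
  assumes s: "s \<in> S" and h: "h \<in> H"
  shows "\<exists>g\<in>carrier G. g \<otimes> h \<otimes> inv g \<otimes> s \<in> S"
proof -
  have "h \<otimes> \<one> \<otimes> s \<in> (H <#> Z) #> s"
    using h subgroup.one_closed[OF subgroup_center] unfolding set_mult_def r_coset_def by blast
  then have "h \<otimes> s \<in> S <#> Z" using S_mult_center_eq_coset[OF s] h by simp
  then obtain t z where t: "t \<in> S" "z \<in> Z" "h \<otimes> s = t \<otimes> z" by (auto simp: set_mult_def)
  obtain g where g: "g \<in> carrier G" "inv g \<otimes> (t \<otimes> inv s) \<otimes> g \<in> H"
    using S_intersects[of t s] intersects_iff s t by blast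
  define k where "k = inv g \<otimes> (t \<otimes> inv s) \<otimes> g"
  have k: "k \<in> H" "k \<in> carrier G" using g by (auto simp: k_def)
  have ts: "t \<otimes> inv s = g \<otimes> k \<otimes> inv g"
    using g s t by (simp add: k_def m_assoc inv_mult_left_cancel)
  define c where "c = commutator G k g"
  have c: "c \<in> Z" using k g by (simp add: c_def commutator_center)
  have iz: "inv c \<in> Z" "z \<in> Z" using c t subgroup.m_inv_closed[OF subgroup_center] by auto
  have "h = t \<otimes> z \<otimes> inv s" using t s h by (metis H_carrier S_carrier center_carrier inv_solve_right m_closed)
  also have "\<dots> = z \<otimes> (t \<otimes> inv s)" using t s center_commute[of z t, symmetric] by (simp add: m_assoc)
  also have "\<dots> = z \<otimes> inv c \<otimes> k"
    using ts conjugate_eq[of k g] k g c t by (simp add: c_def m_assoc)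
  finally have hk: "h = z \<otimes> inv c \<otimes> k" .
  \<comment> \<open>The central factor \<open>d\<close> by which \<open>h\<close> differs from \<open>k\<close> is the correction to be applied to \<open>t\<close>.\<close>
  define d where "d = z \<otimes> inv c"
  have d: "d \<in> Z" using iz subgroup.m_closed[OF subgroup_center] by (simp add: d_def)
  have "d = h \<otimes> inv k" using hk d k h by (metis H_carrier d_def center_carrier inv_solve_right)
  then have dH: "d \<in> H"
    using h k subgroup.m_closed[OF H_subgroup] subgroup.m_inv_closed[OF H_subgroup] by simp
  have "g \<otimes> h \<otimes> inv g \<otimes> s = g \<otimes> (d \<otimes> (k \<otimes> (inv g \<otimes> s)))"
    using hk d k g s by (simp add: d_def[symmetric] m_assoc)
  also have "\<dots> = d \<otimes> (g \<otimes> k \<otimes> inv g \<otimes> s)"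
    using d k g s by (simp add: center_left_commute m_assoc)
  also have "\<dots> = d \<otimes> t" using s t by (simp add: ts[symmetric] m_assoc)
  also have "\<dots> = t \<otimes> d" using d t by (intro center_commute) auto
  also have "\<dots> \<in> S" using t d dH by (intro S_mult_central_stabilizer) auto
  finally show ?thesis using g by blast
qed

section \<open>Functions that depend only on the central factor\<close>

text \<open>
  These functions are the span of the translates of the characteristic vector of \<open>S\<close> by central
  elements, described without reference to a spanning set. Since \<open>s k \<in> S\<close> for
  \<open>k \<in> Z \<inter> H\<close>, the condition forces invariance under \<open>Z \<inter> H\<close>.
\<close>

definition section_functions :: "('a \<Rightarrow> complex) set" where
  "section_functions = {w. (\<forall>x. x \<notin> S <#> Z \<longrightarrow> w x = 0) \<and>
           (\<forall>s\<in>S. \<forall>t\<in>S. \<forall>z\<in>Z. w (s \<otimes> z) = w (t \<otimes> z))}"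

lemma section_functionsI:
  assumes "\<And>x. x \<notin> S <#> Z \<Longrightarrow> w x = 0"
    and "\<And>s t z. s \<in> S \<Longrightarrow> t \<in> S \<Longrightarrow> z \<in> Z \<Longrightarrow> w (s \<otimes> z) = w (t \<otimes> z)"
  shows "w \<in> section_functions"
  unfolding section_functions_def using assms by blast

lemma section_functions_zero: "w \<in> section_functions \<Longrightarrow> x \<notin> S <#> Z \<Longrightarrow> w x = 0"
  unfolding section_functions_def by blast

lemma section_functions_eq:
  "w \<in> section_functions \<Longrightarrow> s \<in> S \<Longrightarrow> t \<in> S \<Longrightarrow> z \<in> Z \<Longrightarrow> w (s \<otimes> z) = w (t \<otimes> z)"
  unfolding section_functions_def by blast

lemma S_Z_carrier: "x \<in> S <#> Z \<Longrightarrow> x \<in> carrier G"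
  by (auto simp: set_mult_def)

lemma S_Z_mult_central_iff:
  assumes "x \<in> carrier G" "z \<in> Z"
  shows "x \<otimes> z \<in> S <#> Z \<longleftrightarrow> x \<in> S <#> Z"
proof -
  have *: "y \<otimes> c \<in> S <#> Z" if "y \<in> S <#> Z" "c \<in> Z" for y c
    using that subgroup.m_closed[OF subgroup_center]
    by (fastforce simp: set_mult_def m_assoc)
  have "x = x \<otimes> z \<otimes> inv z" using assms by (simp add: m_assoc)
  then show ?thesis
    using * assms subgroup.m_inv_closed[OF subgroup_center] by metis
qed

lemma S_Z_conjugate_mult:
  assumes "x \<in> S <#> Z" "h \<in> H" "g \<in> carrier G"
  shows "g \<otimes> h \<otimes> inv g \<otimes> x \<in> S <#> Z"
proof -
  obtain s z where sz: "s \<in> S" "z \<in> Z" "x = s \<otimes> z" using assms by (auto simp: set_mult_def)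
  obtain g0 where g0: "g0 \<in> carrier G" "g0 \<otimes> h \<otimes> inv g0 \<otimes> s \<in> S"
    using conjugate_translate_in_S[OF sz(1) assms(2)] by blast
  let ?c = "commutator G h (inv g \<otimes> g0)"
  have c: "?c \<in> Z" using assms g0 by (intro commutator_center) auto
  have "g \<otimes> h \<otimes> inv g \<otimes> x = g0 \<otimes> h \<otimes> inv g0 \<otimes> (?c \<otimes> (s \<otimes> z))"
    using conjugates_differ_by_commutator[of h g g0] assms g0 sz by (simp add: m_assoc)
  also have "?c \<otimes> (s \<otimes> z) = s \<otimes> (?c \<otimes> z)"
    using c sz by (intro center_left_commute[symmetric]) auto
  also have "g0 \<otimes> h \<otimes> inv g0 \<otimes> (s \<otimes> (?c \<otimes> z)) = (g0 \<otimes> h \<otimes> inv g0 \<otimes> s) \<otimes> (?c \<otimes> z)"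
    using c sz g0 assms by (simp add: m_assoc)
  also have "\<dots> \<in> S <#> Z"
    using g0 subgroup.m_closed[OF subgroup_center c sz(2)] unfolding set_mult_def by blast
  finally show ?thesis .
qed

text \<open>
  For \<open>x = s z\<close> one conjugate of \<open>h\<close> moves \<open>s\<close> to another element of \<open>S\<close>, which \<open>w\<close> cannot
  distinguish from \<open>s\<close>. The other conjugates differ from that one by commutators with \<open>h\<close>, so only
  these remain. Outside \<open>S Z\<close> both sides vanish, as \<open>S Z\<close> is stable under conjugates of \<open>H\<close>.
\<close>

lemma sum_conjugate_translates:
  assumes w: "w \<in> section_functions" and h: "h \<in> H" and x: "x \<in> carrier G"
  shows "(\<Sum>g\<in>carrier G. w (g \<otimes> h \<otimes> inv g \<otimes> x))
       = of_nat (card (carrier G)) * commutator_average G h w x"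
proof -
  have "card (carrier G) \<noteq> 0" using finite_carrier by (metis card_0_eq empty_iff one_closed)
  then have avg: "of_nat (card (carrier G)) * commutator_average G h w x
      = (\<Sum>g\<in>carrier G. w (x \<otimes> commutator G h g))"
    using x by (simp add: commutator_average_def)
  have "(\<Sum>g\<in>carrier G. w (g \<otimes> h \<otimes> inv g \<otimes> x)) = (\<Sum>g\<in>carrier G. w (x \<otimes> commutator G h g))"
  proof (cases "x \<in> S <#> Z")
    case False
    have "w (x \<otimes> commutator G h g) = 0" if "g \<in> carrier G" for g
      using section_functions_zero[OF w] that False S_Z_mult_central_iff[OF x commutator_center] h by simp
    moreover have "w (g \<otimes> h \<otimes> inv g \<otimes> x) = 0" if g: "g \<in> carrier G" for g
    proof -
      have "g \<otimes> inv h \<otimes> inv g \<otimes> (g \<otimes> h \<otimes> inv g \<otimes> x) = x"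
        using g h x by (simp add: m_assoc inv_mult_left_cancel)
      then have "g \<otimes> h \<otimes> inv g \<otimes> x \<notin> S <#> Z"
        using S_Z_conjugate_mult[OF _ subgroup.m_inv_closed[OF H_subgroup h] g] False by metis
      then show ?thesis by (rule section_functions_zero[OF w])
    qed
    ultimately show ?thesis by simp
  next
    case True
    then obtain s z where sz: "s \<in> S" "z \<in> Z" "x = s \<otimes> z" by (auto simp: set_mult_def)
    obtain g0 where g0: "g0 \<in> carrier G" "g0 \<otimes> h \<otimes> inv g0 \<otimes> s \<in> S"
      using conjugate_translate_in_S[OF sz(1) h] by blast
    have "w (g \<otimes> h \<otimes> inv g \<otimes> x) = w (x \<otimes> commutator G h (inv g \<otimes> g0))"
      if g: "g \<in> carrier G" for g
    proof -
      let ?c = "commutator G h (inv g \<otimes> g0)"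
      have c: "?c \<in> Z" using h g g0 by (intro commutator_center) auto
      have zc: "z \<otimes> ?c \<in> Z" using sz c subgroup.m_closed[OF subgroup_center] by blast
      have "g \<otimes> h \<otimes> inv g \<otimes> x = g0 \<otimes> h \<otimes> inv g0 \<otimes> (?c \<otimes> (s \<otimes> z))"
        using conjugates_differ_by_commutator[of h g g0] h g g0 sz by (simp add: m_assoc)
      also have "?c \<otimes> (s \<otimes> z) = s \<otimes> (z \<otimes> ?c)"
        using c sz center_commute[of ?c "s \<otimes> z"] by (simp add: m_assoc)
      also have "g0 \<otimes> h \<otimes> inv g0 \<otimes> (s \<otimes> (z \<otimes> ?c)) = (g0 \<otimes> h \<otimes> inv g0 \<otimes> s) \<otimes> (z \<otimes> ?c)"
        using c sz g0 h by (simp add: m_assoc)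
      finally have "w (g \<otimes> h \<otimes> inv g \<otimes> x) = w (s \<otimes> (z \<otimes> ?c))"
        using section_functions_eq[OF w g0(2) sz(1) zc] by simp
      then show ?thesis using sz c by (simp add: m_assoc)
    qed
    then have "(\<Sum>g\<in>carrier G. w (g \<otimes> h \<otimes> inv g \<otimes> x))
        = (\<Sum>g\<in>carrier G. w (x \<otimes> commutator G h (inv g \<otimes> g0)))" by simp
    also have "\<dots> = (\<Sum>g\<in>carrier G. w (x \<otimes> commutator G h g))"
      by (rule sum_carrier_inv_mult) (fact g0)
    finally show ?thesis .
  qed
  then show ?thesis using avg by simp
qed

lemma commutator_average_section_functions:
  assumes w: "w \<in> section_functions" and h: "h \<in> carrier G"
  shows "commutator_average G h w \<in> section_functions"
proof -
  have "commutator_average G h w x = 0" if "x \<notin> S <#> Z" for x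
    using that section_functions_zero[OF w] h S_Z_mult_central_iff[OF _ commutator_center]
    by (simp add: commutator_average_def)
  moreover have "commutator_average G h w (s \<otimes> z) = commutator_average G h w (t \<otimes> z)"
    if st: "s \<in> S" "t \<in> S" "z \<in> Z" for s t z
  proof -
    have "w (s \<otimes> (z \<otimes> commutator G h g)) = w (t \<otimes> (z \<otimes> commutator G h g))"
      if "g \<in> carrier G" for g
      using st subgroup.m_closed[OF subgroup_center st(3) commutator_center[OF h that]]
      by (intro section_functions_eq[OF w])
    then show ?thesis
      using st h by (simp add: commutator_average_def m_assoc)
  qed
  ultimately show ?thesis by (rule section_functionsI)
qed

lemma char_vector_section_functions: "char_vector S \<in> section_functions"
proof (rule section_functionsI)
  have "S \<subseteq> S <#> Z"
    using subgroup.one_closed[OF subgroup_center] by (force simp: set_mult_def)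
  then show "char_vector S x = 0" if "x \<notin> S <#> Z" for x
    using that by (auto simp: char_vector_def indicator_def)
  show "char_vector S (s \<otimes> z) = char_vector S (t \<otimes> z)" if "s \<in> S" "t \<in> S" "z \<in> Z" for s t z
    using that S_mult_central_iff by (simp add: char_vector_def indicator_def)
qed

text \<open>
  The sum runs over the left translates by the subgroup \<open>g H g\<^sup>-\<^sup>1\<close>, the stabilizer of \<open>\<phi> g \<alpha>\<close>.
\<close>

lemma canonical_combination_conjugate_sum:
  assumes g: "g \<in> carrier G"
  shows "canonical_combination G \<Omega> \<phi>
    (\<lambda>x. if x \<in> carrier G then \<Sum>h\<in>H. w (g \<otimes> h \<otimes> inv g \<otimes> x) else 0)"
proof (rule canonical_combination_if_left_invariant[OF finite_carrier, where \<beta> = "\<phi> g \<alpha>"])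
  show "\<phi> g \<alpha> \<in> \<Omega>" using element_image g point by blast
next
  fix k x assume k: "k \<in> stabilizer G \<phi> (\<phi> g \<alpha>)" and x: "x \<in> carrier G"
  define h0 where "h0 = inv g \<otimes> k \<otimes> g"
  have kc: "k \<in> carrier G" using k stabilizer_subset by blast
  have h0: "h0 \<in> H"
    using k conjugate_fixes_iff[OF g kc] unfolding h0_def stabilizer_def[of G \<phi> "\<phi> g \<alpha>"] by blast
  have "(\<Sum>h\<in>H. w (g \<otimes> h \<otimes> inv g \<otimes> (k \<otimes> x))) = (\<Sum>h\<in>H. w (g \<otimes> (h \<otimes> h0) \<otimes> inv g \<otimes> x))"
    using g x kc by (intro sum.cong refl) (simp add: h0_def m_assoc inv_mult_left_cancel)
  also have "\<dots> = (\<Sum>h\<in>H. w (g \<otimes> h \<otimes> inv g \<otimes> x))"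
    by (rule sum.reindex_bij_witness[where i = "\<lambda>h. h \<otimes> inv h0" and j = "\<lambda>h. h \<otimes> h0"])
       (use h0 H_subgroup in \<open>auto simp: m_assoc subgroup.m_closed subgroup.m_inv_closed\<close>)
  finally show "(if k \<otimes> x \<in> carrier G then \<Sum>h\<in>H. w (g \<otimes> h \<otimes> inv g \<otimes> (k \<otimes> x)) else 0)
      = (if x \<in> carrier G then \<Sum>h\<in>H. w (g \<otimes> h \<otimes> inv g \<otimes> x) else 0)"
    using x kc by simp
qed simp

text \<open>
  Summing the left translates of \<open>w\<close> by \<open>g h g\<^sup>-\<^sup>1\<close> over all \<open>g\<close> and \<open>h\<close> multiplies \<open>w\<close> by
  \<open>|G| n\<close>, where \<open>n\<close> counts the \<open>h\<close> whose average fixes \<open>w\<close>. It is nonzero because of \<open>h = 1\<close>, so \<open>w\<close> is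
  recovered from canonical combinations by division.
\<close>

lemma canonical_combination_if_eigenvector:
  assumes w: "w \<in> section_functions"
    and eigen: "\<And>h. h \<in> H \<Longrightarrow> commutator_average G h w = 0 \<or> commutator_average G h w = w"
  shows "canonical_combination G \<Omega> \<phi> w"
proof -
  define n where "n = card {h \<in> H. commutator_average G h w = w}"
  have supp: "w x = 0" if "x \<notin> carrier G" for x
    using section_functions_zero[OF w] that S_Z_carrier by blast
  have "\<one> \<in> {h \<in> H. commutator_average G h w = w}"
    using commutator_average_one[OF finite_carrier supp] subgroup.one_closed[OF H_subgroup] by auto
  then have n: "n \<noteq> 0" using finite_H by (auto simp: n_def)
  have N: "card (carrier G) \<noteq> 0" using finite_carrier by (metis card_0_eq empty_iff one_closed)
  let ?N = "of_nat (card (carrier G)) :: complex"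
  define u where "u g x = (if x \<in> carrier G then \<Sum>h\<in>H. w (g \<otimes> h \<otimes> inv g \<otimes> x) else 0)" for g x
  have "(\<Sum>g\<in>carrier G. u g x) = ?N * of_nat n * w x" for x
  proof (cases "x \<in> carrier G")
    case True
    have "(\<Sum>g\<in>carrier G. u g x) = (\<Sum>h\<in>H. \<Sum>g\<in>carrier G. w (g \<otimes> h \<otimes> inv g \<otimes> x))"
      using True by (subst sum.swap) (simp add: u_def)
    also have "\<dots> = (\<Sum>h\<in>H. ?N * commutator_average G h w x)"
      using sum_conjugate_translates[OF w _ True] by simp
    also have "\<dots> = (\<Sum>h\<in>H. if commutator_average G h w = w then ?N * w x else 0)"
    proof (intro sum.cong refl)
      fix h assume "h \<in> H"
      then show "?N * commutator_average G h w x
          = (if commutator_average G h w = w then ?N * w x else 0)"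
        using eigen[of h] by auto
    qed
    also have "\<dots> = ?N * of_nat n * w x"
      using finite_H by (simp add: sum.If_cases n_def Int_def mult_ac)
    finally show ?thesis .
  qed (simp add: u_def supp)
  then have "w = (\<lambda>x. inverse (?N * of_nat n) * (\<Sum>g\<in>carrier G. u g x))"
    using n N by (auto simp: fun_eq_iff field_simps)
  moreover have "canonical_combination G \<Omega> \<phi> (\<lambda>x. inverse (?N * of_nat n) * (\<Sum>g\<in>carrier G. u g x))"
    using canonical_combination_conjugate_sum unfolding u_def
    by (intro canonical_combination_scale canonical_combination_sum finite_points finite_carrier) auto
  ultimately show ?thesis by simp
qed

lemma canonical_combination_char_vector: "canonical_combination G \<Omega> \<phi> (char_vector S)"
proof (rule commuting_idempotents_induct[where J = H and W = section_functions
      and e = "commutator_average G"])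
  show "u - v \<in> section_functions" if "u \<in> section_functions" "v \<in> section_functions" for u v
  proof (rule section_functionsI)
    show "(u - v) x = 0" if "x \<notin> S <#> Z" for x
      using section_functions_zero[OF \<open>u \<in> section_functions\<close> that]
        section_functions_zero[OF \<open>v \<in> section_functions\<close> that]
      by simp
    show "(u - v) (s \<otimes> z) = (u - v) (t \<otimes> z)" if "s \<in> S" "t \<in> S" "z \<in> Z" for s t z
      using section_functions_eq[OF \<open>u \<in> section_functions\<close> that]
        section_functions_eq[OF \<open>v \<in> section_functions\<close> that]
      by simp
  qed
  show "canonical_combination G \<Omega> \<phi> (u + v)"
    if "canonical_combination G \<Omega> \<phi> u" "canonical_combination G \<Omega> \<phi> v" for u v
    using finite_points[OF finite_carrier] that by (rule canonical_combination_add)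
qed (use finite_H finite_carrier commutator_average_section_functions commutator_average_diff
      commutator_average_idem commutator_average_commute canonical_combination_if_eigenvector
      char_vector_section_functions in auto)

end

section \<open>Nilpotent groups of class two\<close>

lemma class_two_groupI:
  assumes "nilpotent_group G" and "nilpotency_class G = 2"
  shows "class_two_group G"
proof -
  interpret group G using assms by (simp add: nilpotent_group_def)
  have "\<exists>n. lower_central G n = {\<one>\<^bsub>G\<^esub>}" using assms(1) by (simp add: nilpotent_group_def)
  then have "lower_central G (nilpotency_class G) = {\<one>\<^bsub>G\<^esub>}"
    unfolding nilpotency_class_def by (rule LeastI_ex)
  then have triv: "lower_central G (Suc (Suc 0)) = {\<one>\<^bsub>G\<^esub>}"
    using assms(2) by (simp add: numeral_2_eq_2)
  show ?thesis
  proof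
    fix x y assume x: "x \<in> carrier G" and y: "y \<in> carrier G"
    have c: "commutator G x y \<in> carrier G" using x y by (simp add: commutator_def)
    have "commutator G x y \<in> lower_central G (Suc 0)"
      using x y unfolding lower_central.simps commutator_def by (intro generate.incl) blast
    then have "commutator G (commutator G x y) z \<in> lower_central G (Suc (Suc 0))"
      if "z \<in> carrier G" for z
      using that unfolding lower_central.simps(2)[of G "Suc 0"] commutator_def[of _ "commutator G x y"]
      by (intro generate.incl) blast
    then have triv': "commutator G (commutator G x y) z = \<one>\<^bsub>G\<^esub>" if "z \<in> carrier G" for z
      using triv that by blast
    have "commutator G x y \<otimes>\<^bsub>G\<^esub> z = z \<otimes>\<^bsub>G\<^esub> commutator G x y" if z: "z \<in> carrier G" for z
    proof -
      let ?c = "commutator G x y"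
      have "?c \<otimes>\<^bsub>G\<^esub> z \<otimes>\<^bsub>G\<^esub> inv\<^bsub>G\<^esub> (z \<otimes>\<^bsub>G\<^esub> ?c) = \<one>\<^bsub>G\<^esub>"
        using triv'[OF z] c z by (simp add: commutator_def[of G ?c] inv_mult_group m_assoc)
      then show ?thesis
        using c z by (metis inv_closed inv_equality inv_inv m_closed)
    qed
    then show "commutator G x y \<in> center G" using c unfolding center_def by blast
  qed
qed

theorem theorem1p9:
  fixes G :: "('a, 'm) monoid_scheme" and \<Omega> :: "'b set" and \<phi> :: "'a \<Rightarrow> 'b \<Rightarrow> 'b"
  assumes "group G" and "finite (carrier G)"
    and "nilpotent_group G" and "nilpotency_class G = 2"
    and "transitive_action G \<Omega> \<phi>" and "\<Omega> \<noteq> {}"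
  shows "EKR_module_property G \<Omega> \<phi>"
  unfolding EKR_module_property_def
proof (intro allI impI)
  fix S assume S: "maximum_intersecting_set G \<Omega> \<phi> S"
  obtain \<alpha> where \<alpha>: "\<alpha> \<in> \<Omega>" using assms(6) by blast
  interpret class_two_group G using class_two_groupI assms(3,4) .
  interpret transitive_action G \<Omega> \<phi> by fact
  interpret class_two_maximum_intersecting G \<Omega> \<phi> \<alpha> S
    by unfold_locales (use assms(2) S \<alpha> in auto)
  show "canonical_combination G \<Omega> \<phi> (char_vector S)"
    by (rule canonical_combination_char_vector)
qed

end
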